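(* There is an absolute constant $c > 0$ such that for every finite set $A \subseteq \mathbb{R}$ with $|A| \geq 2$ and every real $K$ with $|A + A| \leq K|A|$, we have \[|A^2 + A^2| \geq c\,\frac{|A|^2}{K^{12}\log |A|}.\]
   Context: $A + A = \{a + a' \mid a, a' \in A\}$ is the sumset, and $A^2 + A^2 = \{a^2 + b^2 \mid a, b \in A\}$ (here $A^2$ denotes the set of squares of elements of $A$). Logarithms are base $2$. *)

theory Defs
  imports Complex_Main "HOL-Library.Set_Algebras"
begin

(* On sets, + is the sumset operation of Set_Algebras.  That theory also makes A^2 denote
   the product set A * A, so the set of squares of elements of A is written as the image
   of A under squaring. *)
definition squares :: "real set \<Rightarrow> real set"
  where "squares A = (\<lambda>a. a\<^sup>2) ` A"

end

theory Submission
  imports Defs "HOL-Analysis.Convex"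
begin

text \<open>
  Let \<open>E\<close> be the number of solutions of \<open>a\<^sup>2 + b\<^sup>2 = c\<^sup>2 + d\<^sup>2\<close> in \<open>A\<close>.  By Cauchy--Schwarz,
  \<open>|A|\<^sup>4 \<le> |A\<^sup>2 + A\<^sup>2| E\<close>, so it is enough to show \<open>E = O(K\<^sup>8 |A|\<^sup>2 log |A|)\<close>,
  since \<open>K \<ge> 1\<close> gives \<open>K\<^sup>8 \<le> K\<^bsup>12\<^esup>\<close>.

  The equation factors as \<open>(a - c)(a + c) = (d - b)(d + b)\<close>.  Apart from the \<open>O(|A|\<^sup>2)\<close> solutions in
  which both sides vanish, a solution has a slope \<open>l = (a + c) / (b + d) = (d - b) / (a - c)\<close> and
  is determined by \<open>l\<close>, \<open>b + d\<close> and \<open>a - c\<close>.  Writing \<open>r\<^sub>Z(l)\<close> for the number of nonzero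
  \<open>z \<in> Z\<close> with \<open>l z \<in> Z\<close>, the number of such solutions is at most the sum of
  \<open>r\<^bsub>A+A\<^esub>(l) r\<^bsub>A-A\<^esub>(l)\<close> over the slopes, hence at most half the sum of the squares of both factors
  (\<open>card_nondegenerate_quadruples\<close>).

  For any finite set \<open>Z\<close>, Solymosi's argument bounds the sum of \<open>r\<^sub>Z(l)\<^sup>2\<close> over \<open>n\<close> slopes by
  \<open>O(|Z + Z|\<^sup>2 (1 + ln n))\<close> (\<open>sum_fibre_squares\<close>).  The points of \<open>Z \<times> Z\<close> in the half plane
  \<open>x > 0\<close> lie on lines through the origin.  Adding the points of two lines of consecutive slope
  gives distinct points of \<open>(Z + Z) \<times> (Z + Z)\<close>, and these lie strictly between the two lines.  So
  there are at most \<open>O(|Z + Z|\<^sup>2 / t\<^sup>2)\<close> lines with at least \<open>t\<close> points, and this estimate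
  for all \<open>t\<close> yields the sum at the cost of a logarithm.

  With \<open>Z = A + A\<close> and \<open>Z = A - A\<close> the sets \<open>Z + Z\<close> are \<open>4A\<close> and \<open>2A - 2A\<close>, of size at most
  \<open>K\<^sup>4 |A|\<close> by the Pluennecke inequality (\<open>plunnecke_fourfold\<close>), which is proved
  here by Petridis's method together with Ruzsa's triangle inequality.
\<close>

section \<open>Sumset estimates in abelian groups\<close>

text \<open>
  Petridis's lemma: if no subset of \<open>X\<close> grows by a smaller factor than \<open>X\<close> when \<open>B\<close> is added,
  then adding a further set \<open>C\<close> does not spoil this factor.  The proof adds the elements \<open>c\<close> of
  \<open>C\<close> one at a time.  Let \<open>W\<close> be the set of those \<open>x \<in> X\<close> for which \<open>x + c\<close> is already in
  \<open>X + C\<close>.  Then \<open>X + C\<close> gains exactly \<open>|X| - |W|\<close> elements, while \<open>X + B + C\<close> gains at most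
  \<open>|X + B| - |W + B|\<close>, because the translate of \<open>W + B\<close> by \<open>c\<close> is already present.
\<close>

lemma petridis_inequality:
  fixes X B C :: "'a::ab_group_add set"
  assumes fin: "finite X" "finite B" "finite C"
    and le: "real (card (X + B)) \<le> \<kappa> * real (card X)"
    and min: "\<And>Z. Z \<subseteq> X \<Longrightarrow> \<kappa> * real (card Z) \<le> real (card (Z + B))"
    and "\<kappa> \<ge> 0"
  shows "real (card (X + B + C)) \<le> \<kappa> * real (card (X + C))"
  using fin(3)
proof (induction C rule: finite_induct)
  case empty
  then show ?case by simp
next
  case (insert c C)
  define W where "W = {x \<in> X. x + c \<in> X + C}"
  have WX: "W \<subseteq> X" by (auto simp: W_def)
  have fW: "finite W" using WX fin(1) finite_subset by blast
  have fXC: "finite (X + C)" and fXB: "finite (X + B)" and fXBC: "finite (X + B + C)"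
    and fXcC: "finite (X + insert c C)"
    using fin insert by (auto intro!: finite_set_plus)
  have lower: "card (X + C) + card (X - W) \<le> card (X + insert c C)"
  proof -
    have "card (X + C) + card (X - W) = card (X + C) + card ((\<lambda>x. x + c) ` (X - W))"
      by (simp add: card_image)
    also have "\<dots> = card ((X + C) \<union> (\<lambda>x. x + c) ` (X - W))"
      using fin(1) fXC by (subst card_Un_disjoint) (auto simp: W_def)
    also have "\<dots> \<le> card (X + insert c C)"
      by (intro card_mono fXcC) (auto elim!: set_plus_elim)
    finally show ?thesis .
  qed
  have sub: "X + B + insert c C \<subseteq> (X + B + C) \<union> (\<lambda>y. y + c) ` (X + B - (W + B))"
  proof
    fix y assume "y \<in> X + B + insert c C"
    then obtain z d where y: "y = z + d" "z \<in> X + B" "d \<in> insert c C"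
      by (auto elim!: set_plus_elim)
    show "y \<in> (X + B + C) \<union> (\<lambda>y. y + c) ` (X + B - (W + B))"
    proof (cases "d = c \<and> z \<in> W + B")
      case True
      then obtain w b where w: "w \<in> W" "b \<in> B" "z = w + b" by (auto elim!: set_plus_elim)
      then obtain x c' where "x \<in> X" "c' \<in> C" "w + c = x + c'"
        by (auto simp: W_def elim!: set_plus_elim)
      then have "y = (x + b) + c'"
        using y(1) w(3) True by (simp add: algebra_simps)
      then show ?thesis using \<open>x \<in> X\<close> \<open>c' \<in> C\<close> w(2) by blast
    next
      case False
      then show ?thesis using y by auto
    qed
  qed
  have "card (X + B + insert c C) \<le> card (X + B + C) + card (X + B - (W + B))"
  proof -
    have "card (X + B + insert c C) \<le> card ((X + B + C) \<union> (\<lambda>y. y + c) ` (X + B - (W + B)))"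
      using sub fXB fXBC by (intro card_mono) auto
    also have "\<dots> \<le> card (X + B + C) + card ((\<lambda>y. y + c) ` (X + B - (W + B)))"
      by (rule card_Un_le)
    finally show ?thesis by (simp add: card_image)
  qed
  moreover have "card (X + B - (W + B)) = card (X + B) - card (W + B)"
    and "card (W + B) \<le> card (X + B)"
    using set_plus_mono2[OF WX order_refl, of B] fXB
    by (auto intro: card_Diff_subset card_mono finite_subset)
  moreover have "card (X - W) = card X - card W" "card W \<le> card X"
    using WX fW fin(1) by (auto intro: card_Diff_subset card_mono)
  ultimately have "real (card (X + B + insert c C))
      \<le> real (card (X + B + C)) + real (card (X + B)) - real (card (W + B))"
    and low: "real (card (X + C)) + real (card X) - real (card W) \<le> real (card (X + insert c C))"
    using lower by linarith+
  moreover have "real (card (X + B + C)) \<le> \<kappa> * real (card (X + C))" by (rule insert.IH)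
  moreover have "\<kappa> * real (card W) \<le> real (card (W + B))" by (rule min[OF WX])
  ultimately have "real (card (X + B + insert c C))
      \<le> \<kappa> * (real (card (X + C)) + real (card X) - real (card W))"
    using le by (simp add: algebra_simps)
  also have "\<dots> \<le> \<kappa> * real (card (X + insert c C))"
    by (rule mult_left_mono[OF low \<open>\<kappa> \<ge> 0\<close>])
  finally show ?case .
qed

text \<open>
  Among the nonempty subsets of \<open>A\<close>, one that minimises \<open>|X + A| / |X|\<close> satisfies the
  hypotheses of Petridis's lemma, and its ratio is at most that of \<open>A\<close> itself.
\<close>

lemma exists_absorbing_subset:
  fixes A :: "'a::ab_group_add set"
  assumes "finite A" "A \<noteq> {}" and K: "real (card (A + A)) \<le> K * real (card A)"
  shows "\<exists>X \<subseteq> A. X \<noteq> {} \<and>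
    (\<forall>C. finite C \<longrightarrow> real (card (X + A + C)) \<le> K * real (card (X + C)))"
proof -
  define ratio where "ratio Z = real (card (Z + A)) / real (card Z)" for Z
  have "finite (Pow A - {{}})" "Pow A - {{}} \<noteq> {}" using assms by auto
  from ex_is_arg_min_if_finite[OF this, of ratio]
  obtain X where X: "X \<subseteq> A" "X \<noteq> {}"
    and least: "\<And>Z. Z \<subseteq> A \<Longrightarrow> Z \<noteq> {} \<Longrightarrow> ratio X \<le> ratio Z"
    by (auto simp: is_arg_min_linorder)
  have fX: "finite X" using X(1) \<open>finite A\<close> finite_subset by blast
  have pos: "real (card Z) > 0" if "Z \<subseteq> A" "Z \<noteq> {}" for Z
    using that \<open>finite A\<close> by (simp add: card_gt_0_iff finite_subset)
  have "ratio X \<le> ratio A" using least assms(2) by blast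
  also have "\<dots> \<le> K"
    using pos[of A] K assms(2) by (simp add: ratio_def divide_le_eq)
  finally have ratioK: "ratio X \<le> K" .
  have "real (card (X + A + C)) \<le> K * real (card (X + C))" if "finite C" for C
  proof -
    have "real (card (X + A + C)) \<le> ratio X * real (card (X + C))"
    proof (rule petridis_inequality[OF fX \<open>finite A\<close> that])
      show "real (card (X + A)) \<le> ratio X * real (card X)"
        using pos[OF X] by (simp add: ratio_def)
      show "ratio X * real (card Z) \<le> real (card (Z + A))" if "Z \<subseteq> X" for Z
      proof (cases "Z = {}")
        case False
        then have "Z \<subseteq> A" using that X(1) by blast
        with False show ?thesis
          using least[of Z] pos[of Z] by (simp add: ratio_def[of Z] le_divide_eq)
      qed auto
      show "ratio X \<ge> 0" by (simp add: ratio_def)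
    qed
    also have "\<dots> \<le> K * real (card (X + C))"
      using ratioK by (rule mult_right_mono) simp
    finally show ?thesis .
  qed
  with X show ?thesis by blast
qed

text \<open>
  Fix a representation \<open>d = b - c\<close> of every difference.  The pair \<open>(x + b, x + c)\<close> then determines
  \<open>d\<close> as the difference of its entries, and after that \<open>x\<close>.
\<close>

lemma ruzsa_triangle_inequality:
  fixes X B C :: "'a::ab_group_add set"
  assumes "finite X" "finite B" "finite C"
  shows "card X * card (B + uminus ` C) \<le> card (X + B) * card (X + C)"
proof -
  have "\<forall>d \<in> B + uminus ` C. \<exists>p. fst p \<in> B \<and> snd p \<in> C \<and> d = fst p - snd p"
    by (force elim!: set_plus_elim)
  then obtain r where r: "\<And>d. d \<in> B + uminus ` C \<Longrightarrow>
      fst (r d) \<in> B \<and> snd (r d) \<in> C \<and> d = fst (r d) - snd (r d)"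
    by metis
  \<comment> \<open>\<open>r\<close> picks the representation of each difference.\<close>
  define h where "h = (\<lambda>(x, d). (x + fst (r d), x + snd (r d)))"
  have "inj_on h (X \<times> (B + uminus ` C))"
  proof (rule inj_onI, clarsimp simp: h_def)
    fix x d y e
    assume d: "d \<in> B + uminus ` C" and e: "e \<in> B + uminus ` C"
      and eq: "x + fst (r d) = y + fst (r e)" "x + snd (r d) = y + snd (r e)"
    have "d = (x + fst (r d)) - (x + snd (r d))" using r[OF d] by simp
    also have "\<dots> = e" unfolding eq using r[OF e] by simp
    finally have "d = e" .
    with eq show "x = y \<and> d = e" by simp
  qed
  moreover have "h ` (X \<times> (B + uminus ` C)) \<subseteq> (X + B) \<times> (X + C)"
    using r by (auto simp: h_def)
  ultimately have "card (X \<times> (B + uminus ` C)) \<le> card ((X + B) \<times> (X + C))"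
    using assms by (intro card_inj_on_le) (auto intro: finite_set_plus)
  then show ?thesis by (simp add: card_cartesian_product)
qed

lemma card_le_card_set_plus:
  fixes A B :: "'a::ab_group_add set"
  assumes "finite A" "finite B" "B \<noteq> {}"
  shows "card A \<le> card (A + B)"
proof -
  obtain b where "b \<in> B" using assms by blast
  have "card A = card ((\<lambda>a. a + b) ` A)" by (simp add: card_image)
  also have "\<dots> \<le> card (A + B)"
    using \<open>b \<in> B\<close> assms by (intro card_mono finite_set_plus) auto
  finally show ?thesis .
qed

text \<open>
  The absorbing set \<open>X\<close> satisfies \<open>|X + nA| \<le> K\<^sup>n |X|\<close> by iteration.  The case \<open>n = 4\<close> bounds
  \<open>4A\<close> since \<open>X\<close> is nonempty and \<open>|X| \<le> |A|\<close>; the case \<open>n = 2\<close> together with the triangle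
  inequality bounds \<open>2A - 2A\<close>.
\<close>

lemma plunnecke_fourfold:
  fixes A :: "'a::ab_group_add set"
  assumes A: "finite A" "A \<noteq> {}" and K: "real (card (A + A)) \<le> K * real (card A)"
    and "K \<ge> 0"
  shows "real (card ((A + A) + (A + A))) \<le> K ^ 4 * real (card A)"
    and "real (card ((A + A) + uminus ` (A + A))) \<le> K ^ 4 * real (card A)"
proof -
  obtain X where X: "X \<subseteq> A" "X \<noteq> {}"
    and step: "\<And>C. finite C \<Longrightarrow> real (card (X + A + C)) \<le> K * real (card (X + C))"
    using exists_absorbing_subset[OF A K] by blast
  have fX: "finite X" using X(1) A(1) finite_subset by blast
  have cX: "0 < card X" "card X \<le> card A"
    using X fX A(1) by (auto simp: card_gt_0_iff intro: card_mono)
  have fin: "finite (A + A)" "finite (A + (A + A))" "finite ((A + A) + (A + A))"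
    using A by (auto intro!: finite_set_plus)
  have 1: "real (card (X + A)) \<le> K * real (card X)"
    using step[of "{0}"] by simp
  have 2: "real (card (X + (A + A))) \<le> K\<^sup>2 * real (card X)"
  proof -
    have "real (card (X + (A + A))) \<le> K * real (card (X + A))"
      using step[OF A(1)] by (simp add: add.assoc)
    also have "\<dots> \<le> K * (K * real (card X))"
      using 1 \<open>K \<ge> 0\<close> by (rule mult_left_mono)
    finally show ?thesis by (simp add: power2_eq_square)
  qed
  have 3: "real (card (X + (A + (A + A)))) \<le> K ^ 3 * real (card X)"
  proof -
    have "real (card (X + (A + (A + A)))) \<le> K * real (card (X + (A + A)))"
      using step[OF fin(1)] by (simp add: add.assoc)
    also have "\<dots> \<le> K * (K\<^sup>2 * real (card X))"
      using 2 \<open>K \<ge> 0\<close> by (rule mult_left_mono)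
    finally show ?thesis by (simp add: power2_eq_square power3_eq_cube)
  qed
  have 4: "real (card (X + (A + A + (A + A)))) \<le> K ^ 4 * real (card X)"
  proof -
    have "real (card (X + (A + A + (A + A)))) \<le> K * real (card (X + (A + (A + A))))"
      using step[OF fin(2)] by (simp add: add.assoc)
    also have "\<dots> \<le> K * (K ^ 3 * real (card X))"
      using 3 \<open>K \<ge> 0\<close> by (rule mult_left_mono)
    finally show ?thesis by (simp add: power4_eq_xxxx power3_eq_cube)
  qed
  have mono: "K ^ 4 * real (card X) \<le> K ^ 4 * real (card A)"
    using cX by (intro mult_left_mono) auto
  have "card ((A + A) + (A + A)) \<le> card (X + (A + A + (A + A)))"
    using card_le_card_set_plus[OF fin(3) fX X(2)] by (simp add: add.commute)
  with 4 mono show "real (card ((A + A) + (A + A))) \<le> K ^ 4 * real (card A)"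
    by linarith
  have "real (card X) * real (card ((A + A) + uminus ` (A + A)))
      \<le> real (card (X + (A + A))) * real (card (X + (A + A)))"
    using ruzsa_triangle_inequality[OF fX fin(1) fin(1)]
    by (metis of_nat_le_iff of_nat_mult)
  also have "\<dots> \<le> (K\<^sup>2 * real (card X)) * (K\<^sup>2 * real (card X))"
    using 2 by (intro mult_mono) auto
  also have "\<dots> = real (card X) * (K ^ 4 * real (card X))"
    by (simp add: power2_eq_square power4_eq_xxxx)
  finally have "real (card ((A + A) + uminus ` (A + A))) \<le> K ^ 4 * real (card X)"
    using cX(1) by simp
  with mono show "real (card ((A + A) + uminus ` (A + A))) \<le> K ^ 4 * real (card A)"
    by linarith
qed

section \<open>Representations as ratios\<close>

text \<open>
  Each ratio representation \<open>l = w / z\<close> in \<open>Z\<close> is recorded by its denominator.  Positive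
  denominators are singled out because in the half plane \<open>x > 0\<close> the sum of two points has a slope
  between the slopes of the summands.
\<close>

definition pos_fibre :: "real set \<Rightarrow> real \<Rightarrow> real set"
  where "pos_fibre Z l = {z \<in> Z. z > 0 \<and> l * z \<in> Z}"

definition fibre :: "real set \<Rightarrow> real \<Rightarrow> real set"
  where "fibre Z l = {z \<in> Z. z \<noteq> 0 \<and> l * z \<in> Z}"

lemma finite_fibres [simp]:
  "finite Z \<Longrightarrow> finite (pos_fibre Z l)" "finite Z \<Longrightarrow> finite (fibre Z l)"
  by (simp_all add: pos_fibre_def fibre_def)

text \<open>
  The geometric step of Solymosi's argument.  An element \<open>z\<close> of \<open>pos_fibre Z l\<close> stands for the
  point \<open>(z, l z)\<close> of \<open>Z \<times> Z\<close> on the line of slope \<open>l\<close>.  When a new largest slope \<open>b\<close> is added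
  to \<open>L\<close>, whose largest slope was \<open>m\<close>, the sums of points on these two lines are distinct and
  have slope strictly between \<open>m\<close> and \<open>b\<close>.  So they are at least \<open>t\<^sup>2\<close> new points below the
  highest line.  A single line has no predecessor, whence the extra term \<open>t\<^sup>2\<close>.
\<close>

lemma sums_of_points_on_lines:
  fixes Z L :: "real set"
  assumes Z: "finite Z" and "finite L" and "\<And>l. l \<in> L \<Longrightarrow> t \<le> card (pos_fibre Z l)"
  shows "card L * t\<^sup>2 \<le> t\<^sup>2 +
    card {p \<in> (Z + Z) \<times> (Z + Z). fst p > 0 \<and> (\<exists>l\<in>L. snd p < l * fst p)}"
    (is "_ \<le> _ + card (?below L)")
  using assms(2,3)
proof (induction L rule: finite_linorder_max_induct)
  case empty
  then show ?case by simp
next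
  case (insert b L)
  have fin: "finite (?below L)" for L
    using Z by (auto intro!: finite_subset[of "?below L" "(Z + Z) \<times> (Z + Z)"] finite_set_plus)
  show ?case
  proof (cases "L = {}")
    case False
    define m where "m = Max L"
    have m: "m \<in> L" "\<And>l. l \<in> L \<Longrightarrow> l \<le> m" "m < b"
      using insert False by (auto simp: m_def)
    define h where "h = (\<lambda>(x, y). (x + y :: real, m * x + b * y))"
    let ?S = "h ` (pos_fibre Z m \<times> pos_fibre Z b)"
    have "inj h"
    proof (rule injI, clarsimp simp: h_def)
      fix x y x' y' :: real
      assume 1: "x + y = x' + y'" and 2: "m * x + b * y = m * x' + b * y'"
      have x: "x = x' + y' - y" using 1 by simp
      from 2 have "(b - m) * (y - y') = 0" unfolding x by (simp add: algebra_simps)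
      then show "x = x' \<and> y = y'" using m(3) x by simp
    qed
    have "t\<^sup>2 \<le> card (pos_fibre Z m) * card (pos_fibre Z b)"
      unfolding power2_eq_square using insert.prems m(1) by (intro mult_mono) auto
    also have "\<dots> = card ?S"
      using \<open>inj h\<close> by (simp add: card_image inj_on_subset card_cartesian_product)
    finally have S: "t\<^sup>2 \<le> card ?S" .
    have disj: "?below L \<inter> ?S = {}"
    proof -
      have False if "x > 0" "y > 0" "l \<in> L" and lt: "m * x + b * y < l * (x + y)" for x y l
      proof -
        have "l * (x + y) \<le> m * (x + y)"
          using m(2)[OF that(3)] that(1,2) by (intro mult_right_mono) auto
        moreover have "m * y < b * y" using m(3) that(2) by simp
        ultimately show False using lt by (simp add: algebra_simps)
      qed
      then show ?thesis by (fastforce simp: h_def pos_fibre_def)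
    qed
    have subL: "?below L \<subseteq> ?below (insert b L)" by auto
    have subS: "?S \<subseteq> ?below (insert b L)"
    proof
      fix p assume "p \<in> ?S"
      then obtain x y where xy: "x \<in> pos_fibre Z m" "y \<in> pos_fibre Z b" and p: "p = h (x, y)"
        by blast
      have "m * x < b * x" using m(3) xy by (simp add: pos_fibre_def)
      then have "snd p < b * fst p" by (simp add: p h_def algebra_simps)
      with xy show "p \<in> ?below (insert b L)" by (auto simp: p h_def pos_fibre_def)
    qed
    have "card (?below L) + card ?S = card (?below L \<union> ?S)"
      using disj fin Z by (intro card_Un_disjoint[symmetric]) auto
    also have "\<dots> \<le> card (?below (insert b L))"
      using subL subS by (intro card_mono fin) auto
    finally have "card (?below L) + t\<^sup>2 \<le> card (?below (insert b L))" using S by linarith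
    moreover have "card L * t\<^sup>2 \<le> t\<^sup>2 + card (?below L)"
      using insert by auto
    moreover have "b \<notin> L" using insert by auto
    ultimately show ?thesis using insert(1) by simp
  qed simp
qed

text \<open>
  The sums lie in \<open>(Z + Z) \<times> (Z + Z)\<close>, and \<open>t \<le> |Z| \<le> |Z + Z|\<close> absorbs the term of the single
  line.
\<close>

lemma card_rich_slopes:
  fixes Z L :: "real set"
  assumes Z: "finite Z" and L: "finite L" and t: "\<And>l. l \<in> L \<Longrightarrow> t \<le> card (pos_fibre Z l)"
  shows "card L * t\<^sup>2 \<le> 2 * (card (Z + Z))\<^sup>2"
proof (cases "L = {} \<or> Z = {}")
  case True
  then show ?thesis using t by (force simp: pos_fibre_def)
next
  case False
  then obtain l where "l \<in> L" by blast
  have "t \<le> card (pos_fibre Z l)" using t[OF \<open>l \<in> L\<close>] .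
  also have "\<dots> \<le> card Z" using Z by (intro card_mono) (auto simp: pos_fibre_def)
  also have "\<dots> \<le> card (Z + Z)" using card_le_card_set_plus[OF Z Z] False by blast
  finally have "t\<^sup>2 \<le> (card (Z + Z))\<^sup>2" by (rule power_mono) simp
  moreover have "card {p \<in> (Z + Z) \<times> (Z + Z). fst p > 0 \<and> (\<exists>l\<in>L. snd p < l * fst p)}
      \<le> card ((Z + Z) \<times> (Z + Z))"
    using Z by (intro card_mono finite_cartesian_product finite_set_plus) auto
  ultimately show ?thesis
    using sums_of_points_on_lines[OF Z L t] by (simp add: card_cartesian_product power2_eq_square)
qed

text \<open>
  The passage from a weak-type bound to a bound on the sum: the hypothesis says that the \<open>n\<close>-th
  largest value of \<open>f\<close> is at most \<open>M / n\<close>, so that the sum is at most \<open>M\<close> times a harmonic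
  number.  Adding values in decreasing order allows comparison of each \<open>1 / (n + 1)\<close>
  with \<open>ln (n + 1) - ln n\<close>.
\<close>

lemma sum_le_of_weak_bound:
  fixes f :: "'a \<Rightarrow> real"
  assumes "finite L" "M \<ge> 0"
    and "\<And>P m. P \<subseteq> L \<Longrightarrow> m \<in> P \<Longrightarrow> (\<forall>x\<in>P. f m \<le> f x) \<Longrightarrow> real (card P) * f m \<le> M"
  shows "sum f L \<le> M * (1 + ln (real (card L)))"
  using assms(1,3)
proof (induction L rule: finite_ranking_induct[where f = "\<lambda>x. - f x"])
  case empty
  then show ?case using \<open>M \<ge> 0\<close> by simp
next
  case (insert x L)
  show ?case
  proof (cases "x \<in> L")
    case True
    then have "insert x L = L" by blast
    then show ?thesis using insert.IH insert.prems by simp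
  next
    case False
    let ?n = "real (card L)"
    have card: "real (card (insert x L)) = ?n + 1" using False insert(1) by simp
    have "real (card (insert x L)) * f x \<le> M"
      by (rule insert.prems) (use insert(2) in auto)
    then have fx: "f x \<le> M / (?n + 1)" unfolding card by (simp add: field_simps)
    show ?thesis
    proof (cases "L = {}")
      case True
      then show ?thesis using fx by simp
    next
      case nonempty: False
      then have n: "?n > 0" using insert(1) by (simp add: card_gt_0_iff)
      have IH: "sum f L \<le> M * (1 + ln ?n)"
        by (rule insert.IH, rule insert.prems) auto
      have "ln (?n / (?n + 1)) \<le> ?n / (?n + 1) - 1"
        using n by (intro ln_le_minus_one) simp
      moreover have "ln (?n / (?n + 1)) = ln ?n - ln (?n + 1)"
        using n by (simp add: ln_div)
      moreover have "?n / (?n + 1) - 1 = - (1 / (?n + 1))"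
        using n by (simp add: field_simps)
      ultimately have "1 / (?n + 1) + (1 + ln ?n) \<le> 1 + ln (?n + 1)" by linarith
      then have "M * (1 / (?n + 1) + (1 + ln ?n)) \<le> M * (1 + ln (?n + 1))"
        using \<open>M \<ge> 0\<close> by (rule mult_left_mono)
      moreover have "sum f (insert x L) = f x + sum f L" using False insert(1) by simp
      ultimately show ?thesis using fx IH card by (simp add: algebra_simps)
    qed
  qed
qed

lemma sum_pos_fibre_squares:
  fixes Z L :: "real set"
  assumes Z: "finite Z" and L: "finite L"
  shows "(\<Sum>l\<in>L. (real (card (pos_fibre Z l)))\<^sup>2)
    \<le> 2 * (real (card (Z + Z)))\<^sup>2 * (1 + ln (real (card L)))"
proof (rule sum_le_of_weak_bound[OF L])
  fix P m assume P: "P \<subseteq> L" "m \<in> P"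
    and least: "\<forall>l\<in>P. (real (card (pos_fibre Z m)))\<^sup>2 \<le> (real (card (pos_fibre Z l)))\<^sup>2"
  have "card P * (card (pos_fibre Z m))\<^sup>2 \<le> 2 * (card (Z + Z))\<^sup>2"
  proof (rule card_rich_slopes[OF Z])
    show "finite P" using P(1) L finite_subset by blast
    show "card (pos_fibre Z m) \<le> card (pos_fibre Z l)" if "l \<in> P" for l
      using least that by (simp add: power2_le_iff_abs_le)
  qed
  then have "real (card P * (card (pos_fibre Z m))\<^sup>2) \<le> real (2 * (card (Z + Z))\<^sup>2)"
    by (simp only: of_nat_le_iff)
  then show "real (card P) * (real (card (pos_fibre Z m)))\<^sup>2 \<le> 2 * (real (card (Z + Z)))\<^sup>2"
    by simp
qed simp

text \<open>
  The points with negative abscissa become points with positive abscissa when \<open>Z\<close> is replaced by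
  \<open>-Z\<close>, which has a sumset of the same size.
\<close>

lemma sum_fibre_squares:
  fixes Z L :: "real set"
  assumes Z: "finite Z" and L: "finite L"
  shows "(\<Sum>l\<in>L. (real (card (fibre Z l)))\<^sup>2)
    \<le> 8 * (real (card (Z + Z)))\<^sup>2 * (1 + ln (real (card L)))"
proof -
  define N where "N = uminus ` Z"
  have N: "finite N" using Z by (simp add: N_def)
  have "N + N = uminus ` (Z + Z)"
    by (force simp: N_def set_plus_image image_iff)
  then have cN: "card (N + N) = card (Z + Z)" by (simp add: card_image)
  have split: "(real (card (fibre Z l)))\<^sup>2
      \<le> 2 * (real (card (pos_fibre Z l)))\<^sup>2 + 2 * (real (card (pos_fibre N l)))\<^sup>2" for l
  proof -
    have "fibre Z l \<subseteq> pos_fibre Z l \<union> uminus ` pos_fibre N l"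
    proof
      fix z assume "z \<in> fibre Z l"
      then have z: "z \<in> Z" "z \<noteq> 0" "l * z \<in> Z" by (auto simp: fibre_def)
      have "z \<in> pos_fibre Z l" if "z > 0" using z that by (simp add: pos_fibre_def)
      moreover have "-z \<in> pos_fibre N l" if "z < 0" using z that by (simp add: pos_fibre_def N_def)
      ultimately show "z \<in> pos_fibre Z l \<union> uminus ` pos_fibre N l"
        using z(2) by (metis UnI1 UnI2 add.inverse_inverse imageI linorder_neqE_linordered_idom)
    qed
    then have "card (fibre Z l) \<le> card (pos_fibre Z l \<union> uminus ` pos_fibre N l)"
      using Z N by (intro card_mono) auto
    also have "\<dots> \<le> card (pos_fibre Z l) + card (uminus ` pos_fibre N l)"
      by (rule card_Un_le)
    finally have "real (card (fibre Z l)) \<le> real (card (pos_fibre Z l)) + real (card (pos_fibre N l))"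
      by (simp add: card_image)
    then have "(real (card (fibre Z l)))\<^sup>2
        \<le> (real (card (pos_fibre Z l)) + real (card (pos_fibre N l)))\<^sup>2"
      by (rule power_mono) simp
    also have "\<dots> \<le> 2 * (real (card (pos_fibre Z l)))\<^sup>2 + 2 * (real (card (pos_fibre N l)))\<^sup>2"
      using sum_squares_bound[of "real (card (pos_fibre Z l))" "real (card (pos_fibre N l))"]
      by (simp add: power2_sum)
    finally show ?thesis .
  qed
  have "(\<Sum>l\<in>L. (real (card (fibre Z l)))\<^sup>2)
      \<le> 2 * (\<Sum>l\<in>L. (real (card (pos_fibre Z l)))\<^sup>2) + 2 * (\<Sum>l\<in>L. (real (card (pos_fibre N l)))\<^sup>2)"
    using sum_mono[of L, OF split] by (simp add: sum.distrib sum_distrib_left)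
  then show ?thesis
    using sum_pos_fibre_squares[OF Z L] sum_pos_fibre_squares[OF N L] unfolding cN by simp
qed

section \<open>The additive energy of the squares\<close>

definition square_quadruples :: "real set \<Rightarrow> (real \<times> real \<times> real \<times> real) set"
  where "square_quadruples A =
    {(a, b, c, d). a \<in> A \<and> b \<in> A \<and> c \<in> A \<and> d \<in> A \<and> a\<^sup>2 + b\<^sup>2 = c\<^sup>2 + d\<^sup>2}"

lemma finite_square_quadruples: "finite A \<Longrightarrow> finite (square_quadruples A)"
  by (rule finite_subset[of _ "A \<times> A \<times> A \<times> A"]) (auto simp: square_quadruples_def)

text \<open>
  Cauchy--Schwarz for the sizes of the fibres of \<open>f\<close>: they add up to \<open>|P|\<close>, and their squares add
  up to the number of collisions.
\<close>

lemma card_squared_le_card_image_mult_collisions: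
  assumes P: "finite P" and S: "finite S" "f ` P \<subseteq> S"
  shows "(card P)\<^sup>2 \<le> card S * card {(p, q). p \<in> P \<and> q \<in> P \<and> f p = f q}"
proof -
  define n where "n = (\<lambda>s. card {p \<in> P. f p = s})"
  have "{(p, q). p \<in> P \<and> q \<in> P \<and> f p = f q}
      = (\<Union>s\<in>S. {p \<in> P. f p = s} \<times> {p \<in> P. f p = s})"
    using S(2) by auto
  also have "card \<dots> = (\<Sum>s\<in>S. (n s)\<^sup>2)"
    using P S(1) by (subst card_UN_disjoint) (auto simp: n_def card_cartesian_product power2_eq_square)
  finally have coll: "card {(p, q). p \<in> P \<and> q \<in> P \<and> f p = f q} = (\<Sum>s\<in>S. (n s)\<^sup>2)" .
  have "P = (\<Union>s\<in>S. {p \<in> P. f p = s})" using S(2) by auto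
  then have "card P = card (\<Union>s\<in>S. {p \<in> P. f p = s})" by simp
  also have "\<dots> = (\<Sum>s\<in>S. n s)"
    using P S(1) by (subst card_UN_disjoint) (auto simp: n_def)
  finally have cP: "card P = (\<Sum>s\<in>S. n s)" .
  have "real ((card P)\<^sup>2) = (\<Sum>s\<in>S. real (n s))\<^sup>2" unfolding cP by simp
  also have "\<dots> \<le> (\<Sum>s\<in>S. (real (n s))\<^sup>2) * real (card S)"
    by (rule sum_squared_le_sum_of_squares)
  also have "\<dots> = real (card S * card {(p, q). p \<in> P \<and> q \<in> P \<and> f p = f q})"
    unfolding coll by simp
  finally show ?thesis by (simp only: of_nat_le_iff)
qed

lemma card_power4_le_squares_energy:
  assumes A: "finite A"
  shows "card A ^ 4 \<le> card (squares A + squares A) * card (square_quadruples A)"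
proof -
  let ?f = "\<lambda>(a, b). a\<^sup>2 + b\<^sup>2 :: real"
  let ?coll = "{(p, q). p \<in> A \<times> A \<and> q \<in> A \<times> A \<and> ?f p = ?f q}"
  have "card A ^ 4 = (card (A \<times> A))\<^sup>2"
    by (simp add: card_cartesian_product power2_eq_square power4_eq_xxxx)
  also have "\<dots> \<le> card (squares A + squares A) * card ?coll"
    using A by (intro card_squared_le_card_image_mult_collisions)
      (auto simp: squares_def intro!: finite_set_plus)
  also have "card ?coll = card (square_quadruples A)"
  proof (rule bij_betw_same_card)
    show "bij_betw (\<lambda>((a, b), c, d). (a, b, c, d)) ?coll (square_quadruples A)"
      by (rule bij_betw_byWitness[where f' = "\<lambda>(a, b, c, d). ((a, b), c, d)"])
        (auto simp: square_quadruples_def)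
  qed
  finally show ?thesis .
qed

text \<open>
  Here \<open>c = \<plusminus>a\<close> and consequently \<open>d = \<plusminus>b\<close>, so two signs determine \<open>c\<close> and \<open>d\<close>.
\<close>

lemma card_degenerate_quadruples:
  assumes A: "finite A"
  shows "card {(a, b, c, d) \<in> square_quadruples A. a\<^sup>2 = c\<^sup>2} \<le> 4 * (card A)\<^sup>2" (is "card ?T \<le> _")
proof -
  define h :: "real \<times> real \<times> real \<times> real \<Rightarrow> real \<times> real \<times> bool \<times> bool"
    where "h = (\<lambda>(a, b, c, d). (a, b, a = c, b = d))"
  have "inj_on h ?T"
    by (rule inj_onI) (auto simp: h_def square_quadruples_def power2_eq_iff)
  moreover have "h ` ?T \<subseteq> A \<times> A \<times> UNIV \<times> UNIV"
    by (auto simp: h_def square_quadruples_def)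
  ultimately have "card ?T \<le> card (A \<times> A \<times> (UNIV :: bool set) \<times> (UNIV :: bool set))"
    using A by (intro card_inj_on_le) auto
  also have "\<dots> = 4 * (card A)\<^sup>2"
    by (simp add: card_cartesian_product power2_eq_square del: UNIV_Times_UNIV)
  finally show ?thesis .
qed

text \<open>
  In \<open>(a - c)(a + c) = (d - b)(b + d)\<close> all factors are nonzero when \<open>a\<^sup>2 \<noteq> c\<^sup>2\<close>.  With
  \<open>l = (a + c) / (b + d)\<close>, the sum \<open>b + d\<close> is carried by \<open>l\<close> to the sum \<open>a + c\<close>, and the
  difference \<open>a - c\<close> to the difference \<open>d - b\<close>.  The three numbers \<open>l\<close>, \<open>b + d\<close>, \<open>a - c\<close> thus
  give both sums and both differences, and these give the quadruple.
\<close>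

lemma card_nondegenerate_quadruples:
  fixes A :: "real set"
  assumes A: "finite A"
  defines "X \<equiv> A + A" and "D \<equiv> A + uminus ` A"
  defines "L \<equiv> (\<lambda>(x, y). x / y) ` (X \<times> X)"
  shows "card {(a, b, c, d) \<in> square_quadruples A. a\<^sup>2 \<noteq> c\<^sup>2}
    \<le> (\<Sum>l\<in>L. card (fibre X l) * card (fibre D l))" (is "card ?T \<le> _")
proof -
  have fin: "finite X" "finite D" "finite L"
    using A by (auto simp: X_def D_def L_def intro!: finite_set_plus)
  define h :: "real \<times> real \<times> real \<times> real \<Rightarrow> real \<times> real \<times> real"
    where "h = (\<lambda>(a, b, c, d). ((a + c) / (b + d), b + d, a - c))"
  have factor: "(a - c) * (a + c) = (d - b) * (b + d)" "a - c \<noteq> 0" "b + d \<noteq> 0"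
    if "(a, b, c, d) \<in> ?T" for a b c d
  proof -
    show eq: "(a - c) * (a + c) = (d - b) * (b + d)"
      using that by (auto simp: square_quadruples_def power2_eq_square algebra_simps)
    have "(a - c) * (a + c) \<noteq> 0"
      using that by (auto simp: square_quadruples_def power2_eq_square algebra_simps)
    then show "a - c \<noteq> 0" "b + d \<noteq> 0" using eq by auto
  qed
  have "inj_on h ?T"
  proof (rule inj_onI)
    fix p q assume p: "p \<in> ?T" and q: "q \<in> ?T" and eq: "h p = h q"
    obtain a b c d where pe: "p = (a, b, c, d)" by (cases p)
    obtain a' b' c' d' where qe: "q = (a', b', c', d')" by (cases q)
    have fp: "(a - c) * (a + c) = (d - b) * (b + d)" "b + d \<noteq> 0"
      using factor p unfolding pe by blast+
    have fq: "(a' - c') * (a' + c') = (d' - b') * (b' + d')"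
      using factor(1) q unfolding qe by blast
    have 1: "b + d = b' + d'" "a - c = a' - c'" and 2: "a + c = a' + c'"
      using eq fp(2) by (auto simp: pe qe h_def)
    have "(d - b) * (b + d) = (d' - b') * (b + d)"
      using fp(1) fq 1 2 by metis
    then have "d - b = d' - b'" using fp(2) by (metis mult_right_cancel)
    then show "p = q" using 1 2 by (simp add: pe qe)
  qed
  moreover have "h ` ?T \<subseteq> (SIGMA l:L. fibre X l \<times> fibre D l)"
  proof
    fix y assume "y \<in> h ` ?T"
    then obtain a b c d where q: "(a, b, c, d) \<in> ?T" and y: "y = h (a, b, c, d)"
      by (metis (no_types, lifting) imageE prod_cases4)
    have mem: "a \<in> A" "b \<in> A" "c \<in> A" "d \<in> A"
      using q by (auto simp: square_quadruples_def)
    note f = factor[OF q]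
    have X: "a + c \<in> X" "b + d \<in> X" using mem by (auto simp: X_def)
    have diff: "u - v \<in> D" if "u \<in> A" "v \<in> A" for u v
    proof -
      have "u + (- v) \<in> D" unfolding D_def using that by (intro set_plus_intro) auto
      then show ?thesis by simp
    qed
    have l: "(a + c) / (b + d) * (a - c) = d - b" using f by (simp add: field_simps)
    have "(a + c) / (b + d) \<in> L" unfolding L_def using X by force
    moreover have "b + d \<in> fibre X ((a + c) / (b + d))" using X f by (simp add: fibre_def)
    moreover have "a - c \<in> fibre D ((a + c) / (b + d))"
      using f(2) l diff mem by (simp add: fibre_def)
    ultimately show "y \<in> (SIGMA l:L. fibre X l \<times> fibre D l)" by (simp add: y h_def)
  qed
  ultimately have "card ?T \<le> card (SIGMA l:L. fibre X l \<times> fibre D l)"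
    using fin by (intro card_inj_on_le) auto
  also have "\<dots> = (\<Sum>l\<in>L. card (fibre X l) * card (fibre D l))"
    using fin by (simp add: card_cartesian_product)
  finally show ?thesis .
qed

lemma card_set_plus_le: "finite A \<Longrightarrow> finite B \<Longrightarrow> card (A + B) \<le> card A * card B"
  unfolding set_plus_image using card_image_le[of "A \<times> B" "\<lambda>(x, y). x + y"]
  by (simp add: card_cartesian_product)

text \<open>
  There are at most \<open>|A + A|\<^sup>2 \<le> |A|\<^sup>4\<close> slopes, so the logarithmic factor is at most
  \<open>1 + 4 ln |A| \<le> 5 log\<^sub>2 |A|\<close>, and each of the two sums of squares is at most
  \<open>8 (K\<^sup>4 |A|)\<^sup>2 \<cdot> 5 log\<^sub>2 |A|\<close>.  The degenerate quadruples contribute the remaining \<open>4\<close> to the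
  constant.
\<close>

lemma card_square_quadruples_le:
  fixes A :: "real set"
  assumes A: "finite A" "card A \<ge> 2" and K: "real (card (A + A)) \<le> K * real (card A)"
  shows "real (card (square_quadruples A)) \<le> 44 * K ^ 8 * (real (card A))\<^sup>2 * log 2 (real (card A))"
proof -
  let ?n = "real (card A)"
  define X where "X = A + A"
  define D where "D = A + uminus ` A"
  define L where "L = (\<lambda>(x, y). x / y) ` (X \<times> X)"
  have ne: "A \<noteq> {}" using A by auto
  have fin: "finite X" "finite D" "finite L"
    using A by (auto simp: X_def D_def L_def intro!: finite_set_plus)
  have "?n \<le> K * ?n"
    using card_le_card_set_plus[OF A(1) A(1) ne] K by linarith
  then have K1: "K \<ge> 1" using A(2) by simp
  have "L \<noteq> {}" using ne by (auto simp: L_def X_def set_plus_image)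
  then have L0: "card L > 0" using fin(3) by (simp add: card_gt_0_iff)
  have "card L \<le> card (X \<times> X)"
    unfolding L_def using fin by (intro card_image_le) auto
  also have "\<dots> = card X * card X" by (simp add: card_cartesian_product)
  also have "\<dots> \<le> (card A * card A) * (card A * card A)"
    using card_set_plus_le[OF A(1) A(1)] by (intro mult_mono) (auto simp: X_def)
  also have "\<dots> = card A ^ 4" by (simp add: power4_eq_xxxx)
  finally have "real (card L) \<le> ?n ^ 4" by (metis of_nat_le_iff of_nat_power)
  then have "ln (real (card L)) \<le> ln (?n ^ 4)" using L0 A(2) by (subst ln_le_cancel_iff) auto
  also have "\<dots> = 4 * ln ?n" using A(2) by (simp add: ln_realpow)
  finally have lnL: "ln (real (card L)) \<le> 4 * ln ?n" .
  have log1: "log 2 ?n \<ge> 1" using A(2) by (simp add: le_log_iff)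
  have "ln ?n = log 2 ?n * ln 2" by (simp add: log_def)
  also have "\<dots> \<le> log 2 ?n * 1"
    using log1 ln_le_minus_one[of 2] by (intro mult_left_mono) auto
  finally have logL: "1 + ln (real (card L)) \<le> 5 * log 2 ?n" using lnL log1 by linarith
  note pl = plunnecke_fourfold[OF A(1) ne K]
  have XX: "real (card (X + X)) \<le> K ^ 4 * ?n" using pl(1) K1 by (simp add: X_def)
  have "D + D = (A + A) + uminus ` (A + A)"
  proof -
    have "uminus ` (A + A) = uminus ` A + uminus ` A"
      by (force simp: set_plus_image image_iff)
    then show ?thesis by (simp add: D_def ac_simps)
  qed
  then have DD: "real (card (D + D)) \<le> K ^ 4 * ?n" using pl(2) K1 by simp
  have energy: "(\<Sum>l\<in>L. (real (card (fibre Z l)))\<^sup>2) \<le> 40 * K ^ 8 * ?n\<^sup>2 * log 2 ?n"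
    if Z: "finite Z" "real (card (Z + Z)) \<le> K ^ 4 * ?n" for Z
  proof -
    have "(\<Sum>l\<in>L. (real (card (fibre Z l)))\<^sup>2)
        \<le> 8 * (real (card (Z + Z)))\<^sup>2 * (1 + ln (real (card L)))"
      by (rule sum_fibre_squares[OF Z(1) fin(3)])
    also have "\<dots> \<le> 8 * (K ^ 4 * ?n)\<^sup>2 * (5 * log 2 ?n)"
      using Z(2) logL L0 by (intro mult_mono power_mono) (auto simp: Suc_leI)
    finally show ?thesis by (simp add: power_mult_distrib flip: power_mult)
  qed
  have amgm: "x * y \<le> (x\<^sup>2 + y\<^sup>2) / 2" for x y :: real
    using sum_squares_bound[of x y] by simp
  let ?Q = "square_quadruples A"
  have "?Q = {(a, b, c, d) \<in> ?Q. a\<^sup>2 = c\<^sup>2} \<union> {(a, b, c, d) \<in> ?Q. a\<^sup>2 \<noteq> c\<^sup>2}" by auto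
  then have "card ?Q \<le> card {(a, b, c, d) \<in> ?Q. a\<^sup>2 = c\<^sup>2} + card {(a, b, c, d) \<in> ?Q. a\<^sup>2 \<noteq> c\<^sup>2}"
    by (metis (no_types, lifting) card_Un_le)
  also have "\<dots> \<le> 4 * (card A)\<^sup>2 + (\<Sum>l\<in>L. card (fibre X l) * card (fibre D l))"
    using card_degenerate_quadruples[OF A(1)] card_nondegenerate_quadruples[OF A(1)]
    unfolding X_def D_def L_def by (rule add_mono)
  finally have "real (card ?Q) \<le> real (4 * (card A)\<^sup>2 + (\<Sum>l\<in>L. card (fibre X l) * card (fibre D l)))"
    by (simp only: of_nat_le_iff)
  also have "\<dots> = 4 * ?n\<^sup>2 + (\<Sum>l\<in>L. real (card (fibre X l)) * real (card (fibre D l)))"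
    by simp
  also have "\<dots> \<le> 4 * ?n\<^sup>2 + (\<Sum>l\<in>L. ((real (card (fibre X l)))\<^sup>2 + (real (card (fibre D l)))\<^sup>2) / 2)"
    by (intro add_left_mono sum_mono amgm)
  also have "\<dots> = 4 * ?n\<^sup>2 + ((\<Sum>l\<in>L. (real (card (fibre X l)))\<^sup>2) + (\<Sum>l\<in>L. (real (card (fibre D l)))\<^sup>2)) / 2"
    by (simp add: sum.distrib flip: sum_divide_distrib)
  also have "\<dots> \<le> 4 * ?n\<^sup>2 + 40 * K ^ 8 * ?n\<^sup>2 * log 2 ?n"
    using energy[OF fin(1) XX] energy[OF fin(2) DD] by simp
  finally have "real (card ?Q) \<le> 4 * ?n\<^sup>2 + 40 * K ^ 8 * ?n\<^sup>2 * log 2 ?n" .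
  moreover have "1 * ?n\<^sup>2 * 1 \<le> K ^ 8 * ?n\<^sup>2 * log 2 ?n"
    using K1 log1 by (intro mult_mono) auto
  ultimately show ?thesis by simp
qed

theorem proposition1p20:
  shows "\<exists>c::real. c > 0 \<and>
    (\<forall>(A::real set) (K::real). finite A \<longrightarrow> card A \<ge> 2 \<longrightarrow> real (card (A + A)) \<le> K * real (card A) \<longrightarrow>
      real (card (squares A + squares A)) \<ge> c * ((real (card A))\<^sup>2 / (K ^ 12 * log 2 (real (card A)))))"
proof (intro exI[of _ "1 / 44"] conjI allI impI)
  fix A :: "real set" and K :: real
  assume A: "finite A" "card A \<ge> 2" and K: "real (card (A + A)) \<le> K * real (card A)"
  let ?n = "real (card A)" and ?s = "real (card (squares A + squares A))"
  have "A \<noteq> {}" using A by auto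
  then have "?n \<le> K * ?n"
    using card_le_card_set_plus[OF A(1) A(1)] K by fastforce
  then have K1: "K \<ge> 1" using A(2) by simp
  have log1: "log 2 ?n \<ge> 1" using A(2) by (simp add: le_log_iff)
  have "?n\<^sup>2 * ?n\<^sup>2 = real (card A ^ 4)" by (simp add: power4_eq_xxxx power2_eq_square)
  also have "\<dots> \<le> real (card (squares A + squares A) * card (square_quadruples A))"
    using card_power4_le_squares_energy[OF A(1)] by (simp only: of_nat_le_iff)
  also have "\<dots> \<le> ?s * (44 * K ^ 8 * ?n\<^sup>2 * log 2 ?n)"
    unfolding of_nat_mult
    using card_square_quadruples_le[OF A K] by (rule mult_left_mono) simp
  also have "\<dots> \<le> ?s * (44 * K ^ 12 * ?n\<^sup>2 * log 2 ?n)"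
    using K1 log1 by (intro mult_left_mono mult_right_mono power_increasing) auto
  also have "\<dots> = ?s * (44 * K ^ 12 * log 2 ?n) * ?n\<^sup>2" by simp
  finally have "?n\<^sup>2 \<le> ?s * (44 * K ^ 12 * log 2 ?n)"
    by (rule mult_right_le_imp_le) (use A(2) in simp)
  then show "?s \<ge> 1 / 44 * (?n\<^sup>2 / (K ^ 12 * log 2 ?n))"
    using K1 log1 by (simp add: field_simps)
qed simp

end
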